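(* Let $a,b\in\mathbb{R}$ with $b-a\in\mathbb{N}_2$, let $1<\alpha_1,\alpha_2<2$, and let $f_1,f_2:\mathbb{N}_{a+1}^{b}\times\mathbb{R}^2\to\mathbb{R}$. Assume: (i) $f_1$ and $f_2$ are continuous. (ii) There exist constants $L_1,L_2,L_3,L_4$ such that for all $(t,u_1,u_2),(t,v_1,v_2)\in\mathbb{N}_{a+1}^{b}\times\mathbb{R}^2$, $$|f_1(t,u_1,u_2)-f_1(t,v_1,v_2)|\le L_1|u_1-v_1|+L_2|u_2-v_2|,$$ $$|f_2(t,u_1,u_2)-f_2(t,v_1,v_2)|\le L_3|u_1-v_1|+L_4|u_2-v_2|.$$ (iii) Put $M_1=\max_{t\in\mathbb{N}_{a+1}^{b}}|f_1(t,0,0)|$ and $M_2=\max_{t\in\mathbb{N}_{a+1}^{b}}|f_2(t,0,0)|$. (iv) $L=\lambda_1(L_1+L_2)+\lambda_2(L_3+L_4)\in(0,1)$, where for $i=1,2$ $$\lambda_i=\left(\frac{b-a-1}{\alpha_i\Gamma(\alpha_i+1)}\right)\left(\frac{(\alpha_i-1)(b-a)+1}{\alpha_i}\right)^{\overline{\alpha_i-1}}.$$ Choose $R$ with $$R\ge\frac{\lambda_1M_1+\lambda_2M_2}{1-[\lambda_1(L_1+L_2)+\lambda_2(L_3+L_4)]}.$$ Further, assume that the spectral radius of the matrix $$H=\begin{pmatrix}\lambda_1L_1&\lambda_1L_2\\ \lambda_2L_3&\lambda_2L_4\end{pmatrix}$$ is less than one. Then the solution of the coupled system $$\begin{cases}\big(\nabla^{\alpha_1}_{\rho(a)}u_1\big)(t)+f_1(t,u_1(t),u_2(t))=0,&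 t\in\mathbb{N}_{a+2}^{b},\\ \big(\nabla^{\alpha_2}_{\rho(a)}u_2\big)(t)+f_2(t,u_1(t),u_2(t))=0,& t\in\mathbb{N}_{a+2}^{b},\\ u_1(a)=0,\quad u_1(b)=0,\\ u_2(a)=0,\quad u_2(b)=0,\end{cases}$$ is Ulam–Hyers stable; that is, the equivalent operator system $u_1=T_1(u_1,u_2)$, $u_2=T_2(u_1,u_2)$ on $X\times X$ is Ulam–Hyers stable, where $X$, $T_1$, $T_2$ and Ulam–Hyers stability are as defined in the context.
   Context: Notation. $\mathbb{N}_c=\{c,c+1,c+2,\ldots\}$ and $\mathbb{N}_c^{d}=\{c,c+1,\ldots,d\}$ for real $c,d$ with $d-c$ a nonnegative integer. So $b-a\in\mathbb{N}_2$ means that $b-a$ is an integer $\ge 2$. $\Gamma$ is the Euler gamma function. The backward jump is $\rho(t)=t-1$; in particular the base point $\rho(a)$ is $a-1$. Generalized rising function: $t^{\overline{r}}=\Gamma(t+r)/\Gamma(t)$ whenever $t$ and $t+r$ are real numbers not in $\{\ldots,-2,-1,0\}$; if $t\in\{\ldots,-2,-1,0\}$ and $t+r\notin\{\ldots,-2,-1,0\}$, then $t^{\overline{r}}=0$ by convention. Nabla Taylor monomial: $H_\mu(t,c)=\dfrac{(t-c)^{\overline{\mu}}}{\Gamma(\mu+1)}$ for real $\mu\notin\{\ldots,-2,-1\}$ (not to be confused with the matrix $H$). Nabla difference: $(\nabla u)(t)=u(t)-u(t-1)$, and $\nabla^2=\nabla\nabla$. Nabla fractional sum of order $\nu>0$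 based at $c$: $(\nabla_c^{-\nu}u)(t)=\sum_{s=c+1}^{t}H_{\nu-1}(t,s-1)u(s)$ for $t\in\mathbb{N}_c$, with value $0$ at $t=c$. Riemann–Liouville nabla fractional difference of order $\nu$ with $1<\nu<2$ based at $c$: $(\nabla_c^{\nu}u)(t)=\big(\nabla^2(\nabla_c^{-(2-\nu)}u)\big)(t)$ for $t\in\mathbb{N}_{c+2}$. Hence for $u$ defined on $\mathbb{N}_a^{b}$ and $t\in\mathbb{N}_{a+2}^{b}$, $(\nabla^{\nu}_{\rho(a)}u)(t)=F(t)-2F(t-1)+F(t-2)$, where $F(t)=\sum_{s=a}^{t}H_{1-\nu}(t,s-1)u(s)$. Spaces. $X=\mathbb{R}^{b-a+1}$ is the Banach space of all functions $u:\mathbb{N}_a^{b}\to\mathbb{R}$ with norm $\|u\|_X=\max_{t\in\mathbb{N}_a^{b}}|u(t)|$. $X\times X$ has the norm $\|(u_1,u_2)\|_{X\times X}=\|u_1\|_X+\|u_2\|_X$. Operators. For $i=1,2$, $T_i:X\times X\to X$ is $$T_i(u_1,u_2)(t)=\sum_{s=a+1}^{b}G_i(t,s)f_i(s,u_1(s),u_2(s)),\quad t\in\mathbb{N}_a^{b},$$ where, for $s\in\mathbb{N}_{a+1}^{b}$, $$G_i(t,s)=\frac{1}{\Gamma(\alpha_i)}\begin{cases}\dfrac{(b-s+1)^{\overline{\alpha_i-1}}}{(b-a)^{\overline{\alpha_i-1}}}(t-a)^{\overline{\alpha_i-1}},& t\in\mathbb{N}_a^{s-1},\\[2mm] \dfrac{(b-s+1)^{\overline{\alpha_i-1}}}{(b-a)^{\overline{\alpha_i-1}}}(t-a)^{\overline{\alpha_i-1}}-(t-s+1)^{\overline{\alpha_i-1}},&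 t\in\mathbb{N}_s^{b}.\end{cases}$$ A pair $(u_1,u_2)\in X\times X$ solves the boundary value system if and only if $u_1=T_1(u_1,u_2)$ and $u_2=T_2(u_1,u_2)$. Ulam–Hyers stability. For a Banach space $X$ and operators $T_1,T_2:X\times X\to X$, the system $u_1=T_1(u_1,u_2)$, $u_2=T_2(u_1,u_2)$ is Ulam–Hyers stable if there exist $C_1,C_2,C_3,C_4>0$ such that for all $\varepsilon_1,\varepsilon_2>0$ and each pair $(u_1^*,u_2^* )\in X\times X$ with $\|u_1^*-T_1(u_1^*,u_2^* )\|_X\le\varepsilon_1$ and $\|u_2^*-T_2(u_1^*,u_2^* )\|_X\le\varepsilon_2$, there exists a solution $(v_1^*,v_2^* )\in X\times X$ of the system with $\|u_1^*-v_1^*\|_X\le C_1\varepsilon_1+C_2\varepsilon_2$ and $\|u_2^*-v_2^*\|_X\le C_3\varepsilon_1+C_4\varepsilon_2$. *)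

theory Defs
  imports "HOL-Analysis.Analysis" "Jordan_Normal_Form.Spectral_Radius"
begin

definition N_from :: "real \<Rightarrow> real set" where
  "N_from c = {c + real k | k :: nat. True}"

definition N_upto :: "real \<Rightarrow> real \<Rightarrow> real set" where
  "N_upto c d = {t \<in> N_from c. t \<le> d}"

text \<open>
  The value \<open>0\<close> covers the convention for a pole of the denominator only. It is also the
  junk value in the cases where the rising function is undefined (\<open>t + r\<close> a nonpositive integer).
\<close>

definition rising :: "real \<Rightarrow> real \<Rightarrow> real" where
  "rising t r = (if t \<in> \<int>\<^sub>\<le>\<^sub>0 \<or> t + r \<in> \<int>\<^sub>\<le>\<^sub>0 then 0 else Gamma (t + r) / Gamma t)"

definition nabla_taylor :: "real \<Rightarrow> real \<Rightarrow> real \<Rightarrow> real" where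
  "nabla_taylor \<mu> t c = rising (t - c) \<mu> / Gamma (\<mu> + 1)"

definition nabla :: "(real \<Rightarrow> real) \<Rightarrow> real \<Rightarrow> real" where
  "nabla u t = u t - u (t - 1)"

text \<open>In \<open>nabla_sum c \<nu> u\<close> and \<open>nabla_diff c \<nu> u\<close>, \<open>c\<close> is the base point and \<open>\<nu>\<close> the order.\<close>

definition nabla_sum :: "real \<Rightarrow> real \<Rightarrow> (real \<Rightarrow> real) \<Rightarrow> real \<Rightarrow> real" where
  "nabla_sum c \<nu> u t = (\<Sum>s\<in>N_upto (c + 1) t. nabla_taylor (\<nu> - 1) t (s - 1) * u s)"

text \<open>Riemann--Liouville difference, meaningful for \<open>1 < \<nu> < 2\<close>.\<close>

definition nabla_diff :: "real \<Rightarrow> real \<Rightarrow> (real \<Rightarrow> real) \<Rightarrow> real \<Rightarrow> real" where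
  "nabla_diff c \<nu> u = nabla (nabla (nabla_sum c (2 - \<nu>) u))"

text \<open>
  The space of functions on \<open>N_upto a b\<close>: each is represented by its extension by zero,
  so that equality in the space is equality of HOL functions and the pointwise operations are
  the vector space operations.
\<close>

definition grid_space :: "real \<Rightarrow> real \<Rightarrow> (real \<Rightarrow> real) set" where
  "grid_space a b = {u. \<forall>t. t \<notin> N_upto a b \<longrightarrow> u t = 0}"

definition grid_norm :: "real \<Rightarrow> real \<Rightarrow> (real \<Rightarrow> real) \<Rightarrow> real" where
  "grid_norm a b u = Max ((\<lambda>t. \<bar>u t\<bar>) ` N_upto a b)"

definition green :: "real \<Rightarrow> real \<Rightarrow> real \<Rightarrow> real \<Rightarrow> real \<Rightarrow> real" where
  "green a b \<alpha> t s = 1 / Gamma \<alpha> *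
     (if t \<in> N_upto a (s - 1)
      then rising (b - s + 1) (\<alpha> - 1) / rising (b - a) (\<alpha> - 1) * rising (t - a) (\<alpha> - 1)
      else rising (b - s + 1) (\<alpha> - 1) / rising (b - a) (\<alpha> - 1) * rising (t - a) (\<alpha> - 1)
           - rising (t - s + 1) (\<alpha> - 1))"

definition green_op ::
  "real \<Rightarrow> real \<Rightarrow> real \<Rightarrow> (real \<times> real \<times> real \<Rightarrow> real) \<Rightarrow>
   (real \<Rightarrow> real) \<Rightarrow> (real \<Rightarrow> real) \<Rightarrow> real \<Rightarrow> real" where
  "green_op a b \<alpha> f u1 u2 t =
     (if t \<in> N_upto a b then \<Sum>s\<in>N_upto (a + 1) b. green a b \<alpha> t s * f (s, u1 s, u2 s) else 0)"

text \<open>The base point \<open>a - 1\<close> below is the backward jump of \<open>a\<close>.\<close>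

definition coupled_bvp ::
  "real \<Rightarrow> real \<Rightarrow> real \<Rightarrow> real \<Rightarrow>
   (real \<times> real \<times> real \<Rightarrow> real) \<Rightarrow> (real \<times> real \<times> real \<Rightarrow> real) \<Rightarrow>
   (real \<Rightarrow> real) \<Rightarrow> (real \<Rightarrow> real) \<Rightarrow> bool" where
  "coupled_bvp a b \<alpha>1 \<alpha>2 f1 f2 u1 u2 \<longleftrightarrow>
     (\<forall>t\<in>N_upto (a + 2) b. nabla_diff (a - 1) \<alpha>1 u1 t + f1 (t, u1 t, u2 t) = 0) \<and>
     (\<forall>t\<in>N_upto (a + 2) b. nabla_diff (a - 1) \<alpha>2 u2 t + f2 (t, u1 t, u2 t) = 0) \<and>
     u1 a = 0 \<and> u1 b = 0 \<and> u2 a = 0 \<and> u2 b = 0"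

definition green_const :: "real \<Rightarrow> real \<Rightarrow> real \<Rightarrow> real" where
  "green_const a b \<alpha> =
     ((b - a - 1) / (\<alpha> * Gamma (\<alpha> + 1))) * rising (((\<alpha> - 1) * (b - a) + 1) / \<alpha>) (\<alpha> - 1)"

text \<open>
  The Banach space is given by a carrier set \<open>X\<close> and a norm \<open>nrm\<close> on it, because the dimension
  of the space in question depends on the values of \<open>a\<close> and \<open>b\<close>.
\<close>

definition ulam_hyers_stable ::
  "'x::minus set \<Rightarrow> ('x \<Rightarrow> real) \<Rightarrow> ('x \<Rightarrow> 'x \<Rightarrow> 'x) \<Rightarrow> ('x \<Rightarrow> 'x \<Rightarrow> 'x) \<Rightarrow> bool" where
  "ulam_hyers_stable X nrm T1 T2 \<longleftrightarrow>
     (\<exists>C1 C2 C3 C4 :: real. C1 > 0 \<and> C2 > 0 \<and> C3 > 0 \<and> C4 > 0 \<and>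
       (\<forall>\<epsilon>1 \<epsilon>2 :: real. \<epsilon>1 > 0 \<longrightarrow> \<epsilon>2 > 0 \<longrightarrow>
         (\<forall>u1\<in>X. \<forall>u2\<in>X. nrm (u1 - T1 u1 u2) \<le> \<epsilon>1 \<longrightarrow> nrm (u2 - T2 u1 u2) \<le> \<epsilon>2 \<longrightarrow>
           (\<exists>v1\<in>X. \<exists>v2\<in>X. v1 = T1 v1 v2 \<and> v2 = T2 v1 v2 \<and>
              nrm (u1 - v1) \<le> C1 * \<epsilon>1 + C2 * \<epsilon>2 \<and>
              nrm (u2 - v2) \<le> C3 * \<epsilon>1 + C4 * \<epsilon>2))))"

end

theory Submission
  imports Defs
begin

text \<open>
  On the grid, the boundary value problem is a convolution equation with \<open>(1 - z)^\<alpha>\<close>; multiplying by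
  the power series \<open>(1 - z)^(-\<alpha>)\<close> solves it and gives the Green's function.

  The row sums of the Green's function over all of \<open>{a+1..b}\<close> may exceed the constant \<open>\<lambda>\<close> of the
  statement, since the real point at which \<open>\<lambda>\<close> is evaluated need not be a grid point. However, the
  operators map into functions vanishing at \<open>a\<close> and \<open>b\<close>, so only the columns below \<open>b\<close> matter for
  the contraction, and those row sums are at most \<open>\<lambda>\<close>. Hence, up to the errors at \<open>b\<close>, the pair of
  operators contracts the maximum norm over the interior points with factor \<open>L < 1\<close>, which yields a
  fixed point and the stability estimates.
\<close>

section \<open>The rising function\<close>

lemma Gamma_plus1_pos: "x > 0 \<Longrightarrow> Gamma (x + 1) = x * Gamma (x :: real)"
  by (auto intro!: Gamma_plus1 elim!: nonpos_Ints_cases)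

lemma rising_0_left [simp]: "rising 0 r = 0"
  by (simp add: rising_def)

lemma rising_eq_Gamma: "x > 0 \<Longrightarrow> x + r > 0 \<Longrightarrow> rising x r = Gamma (x + r) / Gamma x"
  by (auto simp: rising_def elim!: nonpos_Ints_cases)

lemma rising_pos: "x > 0 \<Longrightarrow> r > 0 \<Longrightarrow> rising x r > 0"
  by (simp add: rising_eq_Gamma)

lemma rising_of_nat_nonneg: "r > 0 \<Longrightarrow> rising (real n) r \<ge> 0"
  using rising_pos[of "real n" r] by (cases "n = 0") auto

lemma rising_1_left: "r > 0 \<Longrightarrow> rising 1 r = Gamma (r + 1)"
  by (simp add: rising_eq_Gamma add.commute)

lemma rising_plus1:
  assumes "x > 0" "r > 0"
  shows "rising (x + 1) r = rising x r * (x + r) / x"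
proof -
  have "Gamma (x + 1) = x * Gamma x" "Gamma (x + r + 1) = (x + r) * Gamma (x + r)"
    using assms by (auto intro!: Gamma_plus1_pos)
  then show ?thesis
    using assms by (simp add: rising_eq_Gamma add_ac mult_ac)
qed

text \<open>The logarithm of \<open>rising z r\<close> has derivative
  \<open>Digamma (z + r) - Digamma z\<close>, which is nonnegative because Digamma increases on the
  positive reals.\<close>

lemma rising_mono:
  assumes "0 < x" "x \<le> y" "r > 0"
  shows "rising x r \<le> rising y r"
proof -
  have "ln_Gamma (x + r) - ln_Gamma x \<le> ln_Gamma (y + r) - ln_Gamma y"
  proof (rule DERIV_nonneg_imp_nondecreasing[OF \<open>x \<le> y\<close>])
    fix z assume z: "x \<le> z" "z \<le> y"
    have "((\<lambda>z. ln_Gamma (z + r) - ln_Gamma z) has_real_derivative Digamma (z + r) - Digamma z) (at z)"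
      using z assms by (auto intro!: derivative_eq_intros)
    then show "\<exists>d. ((\<lambda>z. ln_Gamma (z + r) - ln_Gamma z) has_real_derivative d) (at z) \<and> 0 \<le> d"
      using Digamma_real_mono[of z "z + r"] z assms by fastforce
  qed
  then have "exp (ln_Gamma (x + r) - ln_Gamma x) \<le> exp (ln_Gamma (y + r) - ln_Gamma y)"
    by simp
  then show ?thesis
    using assms by (simp add: rising_eq_Gamma Gamma_real_pos_exp exp_diff)
qed

lemma rising_of_nat_mono:
  assumes "r > 0" "m \<le> n"
  shows "rising (real m) r \<le> rising (real n) r"
  using rising_mono[of "real m" "real n" r] rising_of_nat_nonneg[of r n] assms
  by (cases "m = 0") auto

text \<open>
  The quotient of the two sides decreases under \<open>k \<mapsto> k + 1\<close> and tends to \<open>1\<close>.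
\<close>

lemma rising_interpolation:
  assumes "k > 0" "0 \<le> \<theta>" "\<theta> \<le> 1" "0 < r" "r \<le> 1"
  shows "rising k r * (1 + \<theta> * r / k) \<le> rising (k + \<theta>) r"
proof -
  define Q where "Q x = rising (x + \<theta>) r / (rising x r * (1 + \<theta> * r / x))" for x
  have den: "1 + \<theta> * r / x > 0" if "x > 0" for x
    using that assms by (simp add: add_pos_nonneg)
  have Qpos: "Q x > 0" if "x > 0" for x
    using that assms den[OF that] by (auto simp: Q_def intro!: divide_pos_pos mult_pos_pos rising_pos)
  have step: "Q (x + 1) \<le> Q x" if x: "x > 0" for x
  proof -
    \<comment> \<open>This is \<open>Q (x + 1) \<le> Q x\<close> with denominators cleared: the
      difference of the two cubic products collapses to a single nonnegative term.\<close>
    have "(x + \<theta>) * (x + r) * (x + 1 + \<theta> * r) - (x + \<theta> + r) * (x + \<theta> * r) * (x + 1)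
        = \<theta> * r * ((1 - \<theta>) * (1 - r))"
      by (simp add: algebra_simps)
    moreover have "\<dots> \<ge> 0"
      using assms by simp
    ultimately have le: "(x + \<theta> + r) * (x + \<theta> * r) * (x + 1) \<le> (x + \<theta>) * (x + r) * (x + 1 + \<theta> * r)"
      by linarith
    have pos: "x + \<theta> > 0" "x + r > 0" "x + 1 + \<theta> * r > 0" "x + \<theta> * r > 0"
      using x assms by (auto intro!: add_pos_nonneg)
    have r1: "rising (x + 1 + \<theta>) r = rising (x + \<theta>) r * (x + \<theta> + r) / (x + \<theta>)"
      using rising_plus1[of "x + \<theta>" r] pos assms by (simp add: add_ac)
    have r2: "rising (x + 1) r = rising x r * (x + r) / x"
      using rising_plus1[of x r] x assms by simp
    have rp: "rising x r > 0"
      using rising_pos x assms by blast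
    have e1: "1 + \<theta> * r / (x + 1) = (x + 1 + \<theta> * r) / (x + 1)" "1 + \<theta> * r / x = (x + \<theta> * r) / x"
      using x by (auto simp: field_simps)
    have "Q (x + 1) = Q x * ((x + \<theta> + r) * (x + \<theta> * r) * (x + 1) / ((x + \<theta>) * (x + r) * (x + 1 + \<theta> * r)))"
      unfolding Q_def r1 r2 e1 using x pos rp by (simp add: divide_simps)
    also have "\<dots> \<le> Q x * 1"
      using le pos Qpos[OF x] by (intro mult_left_mono) auto
    finally show ?thesis
      by simp
  qed
  have dec: "Q (k + real n) \<le> Q k" for n
  proof (induction n)
    case (Suc n)
    then show ?case
      using step[of "k + real n"] assms by (simp add: add_ac)
  qed simp
  \<comment> \<open>Monotonicity of \<open>rising\<close> gives only a crude lower bound, but one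
    that tends to 1 as x grows; taken at \<open>k + real n\<close> it stays below
    \<open>Q k\<close>.\<close>
  have low: "inverse (1 + \<theta> * r / x) \<le> Q x" if x: "x > 0" for x
  proof -
    have "rising x r \<le> rising (x + \<theta>) r" "rising x r > 0"
      using rising_mono[of x "x + \<theta>" r] rising_pos x assms by auto
    then show ?thesis
      using den[OF x] by (simp add: Q_def divide_simps)
  qed
  have "(\<lambda>n. inverse (1 + \<theta> * r / (k + real n))) \<longlonglongrightarrow> inverse (1 + 0)"
    by (intro tendsto_intros real_tendsto_divide_at_top filterlim_tendsto_add_at_top[OF tendsto_const]
        filterlim_real_sequentially) auto
  then have "1 \<le> Q k"
    using low dec assms
    by (intro LIMSEQ_le_const2[where X = "\<lambda>n. inverse (1 + \<theta> * r / (k + real n))"])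
       (auto intro!: exI[of _ 0] order_trans[OF low dec])
  then show ?thesis
    using den[OF \<open>k > 0\<close>] rising_pos[of k r] assms by (simp add: Q_def divide_simps)
qed

text \<open>The right-hand side is the line through the values at 1 and 2, and for r \<le> 1 the
  sequence is concave. In the induction the slack is \<open>r * ((1 - r) * (m - 1))\<close>.\<close>

lemma rising_of_nat_upper:
  assumes "0 < r" "r \<le> 1" "n > 0"
  shows "rising (real n) r \<le> Gamma (r + 1) * (1 + r * (real n - 1))"
  using \<open>n > 0\<close>
proof (induction n rule: nat_induct_non_zero)
  case 1
  then show ?case
    using assms by (simp add: rising_1_left)
next
  case (Suc n)
  define m where "m = real n"
  have m: "m \<ge> 1"
    using Suc by (simp add: m_def)
  have "m * (1 + r * m) - (1 + r * (m - 1)) * (m + r) = r * ((1 - r) * (m - 1))"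
    by (simp add: algebra_simps)
  moreover have "\<dots> \<ge> 0"
    using m assms by simp
  ultimately have "(1 + r * (m - 1)) * (m + r) / m \<le> 1 + r * m"
    using m by (simp add: divide_simps mult.commute)
  then have le: "Gamma (r + 1) * ((1 + r * (m - 1)) * (m + r) / m) \<le> Gamma (r + 1) * (1 + r * m)"
    using assms by (intro mult_left_mono) auto
  have "rising (m + 1) r = rising m r * ((m + r) / m)"
    using m assms by (simp add: rising_plus1)
  also have "\<dots> \<le> Gamma (r + 1) * (1 + r * (m - 1)) * ((m + r) / m)"
    using Suc.IH m assms by (intro mult_right_mono) (auto simp: m_def)
  also have "\<dots> \<le> Gamma (r + 1) * (1 + r * m)"
    using le by simp
  finally show ?case
    by (simp add: m_def add.commute)
qed

text \<open>A hockey-stick identity: the right-hand side equals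
  \<open>rising (real n) (r + 1) / (r + 1)\<close>.\<close>

lemma sum_rising:
  assumes "r > 0"
  shows "(\<Sum>j=1..n. rising (real j) r) = rising (real n) r * (real n + r) / (1 + r)"
proof (induction n)
  case (Suc n)
  show ?case
  proof (cases "n = 0")
    case False
    then have "rising (real n) r * (real n + r) = real n * rising (real n + 1) r"
      using rising_plus1[of "real n" r] assms by simp
    with Suc show ?thesis
      using assms by (simp add: field_simps)
  qed (use assms in auto)
qed simp

text \<open>The quotient \<open>rising (n - j) r / rising n r\<close> grows with n, because the
  growth factor \<open>(z + r) / z\<close> decreases in z and so is larger at the smaller argument.
  The product form also admits the argument 0. This is what makes the Green's function
  nonnegative.\<close>

lemma rising_quotient_mono:
  assumes "r > 0" "j \<le> k" "k \<le> n"
  shows "rising (real (k - j)) r * rising (real n) r \<le> rising (real (n - j)) r * rising (real k) r"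
  using \<open>k \<le> n\<close>
proof (induction n rule: dec_induct)
  case (step n)
  show ?case
  proof (cases "j < n \<and> 0 < k")
    case False
    then have "k - j = 0"
      using assms step.hyps by auto
    then show ?thesis
      using assms by (simp add: rising_of_nat_nonneg)
  next
    case True
    define x y where "x = real n" and "y = real (n - j)"
    have xy: "0 < y" "y \<le> x"
      using True by (auto simp: x_def y_def)
    have "rising (real (k - j)) r * rising (x + 1) r = rising (real (k - j)) r * rising x r * ((x + r) / x)"
      using xy assms by (simp add: rising_plus1)
    also have "\<dots> \<le> rising y r * rising (real k) r * ((x + r) / x)"
      using step.IH xy assms by (intro mult_right_mono) (auto simp: x_def y_def)
    also have "\<dots> \<le> rising y r * rising (real k) r * ((y + r) / y)"
      using xy assms rising_pos[of y r] rising_of_nat_nonneg[of r k]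
      by (intro mult_left_mono) (auto simp: field_simps)
    also have "\<dots> = rising (y + 1) r * rising (real k) r"
      using xy assms by (simp add: rising_plus1)
    finally show ?thesis
      using True by (simp add: x_def y_def add.commute Suc_diff_le)
  qed
qed simp

section \<open>The boundary value problem on the grid\<close>

text \<open>The binomial series of (1 - z)^(-\<alpha>).\<close>

definition gen_binomial_fps :: "real \<Rightarrow> real fps" where
  "gen_binomial_fps \<alpha> = Abs_fps (\<lambda>m. pochhammer \<alpha> m / fact m)"

text \<open>Exponents add, by the Vandermonde convolution for \<open>pochhammer\<close>.\<close>

lemma gen_binomial_fps_mult:
  "gen_binomial_fps \<alpha> * gen_binomial_fps \<beta> = gen_binomial_fps (\<alpha> + \<beta>)"
proof (rule fps_ext)
  fix n
  have "(\<Sum>i=0..n. pochhammer \<alpha> i / fact i * (pochhammer \<beta> (n - i) / fact (n - i)))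
      = (\<Sum>i\<le>n. real (n choose i) * pochhammer \<alpha> i * pochhammer \<beta> (n - i) / fact n)"
    by (intro sum.cong) (auto simp: atMost_atLeast0 binomial_fact)
  also have "\<dots> = pochhammer (\<alpha> + \<beta>) n / fact n"
    by (simp add: pochhammer_binomial_sum sum_divide_distrib)
  finally show "fps_nth (gen_binomial_fps \<alpha> * gen_binomial_fps \<beta>) n = fps_nth (gen_binomial_fps (\<alpha> + \<beta>)) n"
    by (simp add: gen_binomial_fps_def fps_mult_nth)
qed

text \<open>The series has coefficients n + 1; one factor 1 - z turns them into the constant 1, the
  second into the unit series. Since (1 - z)^2 represents the second nabla difference, this is what
  later inverts the fractional difference.\<close>

lemma gen_binomial_fps_2: "(1 - fps_X)\<^sup>2 * gen_binomial_fps 2 = 1"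
proof -
  have "pochhammer 2 n = (fact (Suc n) :: real)" for n :: nat
    by (induction n) (auto simp: pochhammer_Suc algebra_simps)
  then have nth: "fps_nth (gen_binomial_fps 2) n = real n + 1" for n
    by (simp add: gen_binomial_fps_def)
  have "(1 - fps_X) * gen_binomial_fps 2 = Abs_fps (\<lambda>_. 1)"
  proof (rule fps_ext)
    fix n show "fps_nth ((1 - fps_X) * gen_binomial_fps 2) n = fps_nth (Abs_fps (\<lambda>_. 1)) n"
      by (cases n) (auto simp: nth algebra_simps)
  qed
  moreover have "(1 - fps_X) * Abs_fps (\<lambda>_. 1 :: real) = 1"
    by (rule fps_ext) (auto simp: left_diff_distrib)
  ultimately show ?thesis
    by (simp add: power2_eq_square mult.assoc)
qed

text \<open>The coefficients are nabla Taylor monomials, so fractional sums become Cauchy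
  products.\<close>

lemma fps_nth_gen_binomial:
  assumes "\<alpha> > 0"
  shows "fps_nth (gen_binomial_fps \<alpha>) m = rising (real m + 1) (\<alpha> - 1) / Gamma \<alpha>"
proof -
  have "\<alpha> \<notin> \<int>\<^sub>\<le>\<^sub>0"
    using assms by (auto elim!: nonpos_Ints_cases)
  then show ?thesis
    using assms Gamma_fact[of m, where ?'a = real]
    by (simp add: gen_binomial_fps_def pochhammer_Gamma rising_eq_Gamma add_ac)
qed

lemma fps_nth_cong_mult:
  fixes A Y Z :: "'a::comm_ring_1 fps"
  assumes "\<And>i. i \<le> m \<Longrightarrow> fps_nth Y i = fps_nth Z i"
  shows "fps_nth (A * Y) m = fps_nth (A * Z) m"
  using assms by (simp add: fps_mult_nth)

section \<open>Grids as index ranges of natural numbers\<close>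

lemma N_from_2_cases:
  assumes "b - a \<in> N_from 2"
  obtains n where "b = a + real n" "n \<ge> 2"
proof -
  obtain k where "b - a = 2 + real k"
    using assms by (auto simp: N_from_def)
  then show ?thesis
    by (intro that[of "k + 2"]) auto
qed

lemma N_upto_shift: "N_upto (a + real i) (a + real n) = (\<lambda>j. a + real j) ` {i..n}"
proof (intro equalityI subsetI)
  fix t assume "t \<in> N_upto (a + real i) (a + real n)"
  then obtain k where "t = a + real (i + k)" "t \<le> a + real n"
    by (auto simp: N_upto_def N_from_def add_ac)
  then show "t \<in> (\<lambda>j. a + real j) ` {i..n}"
    by (intro image_eqI[of _ _ "i + k"]) auto
next
  fix t assume "t \<in> (\<lambda>j. a + real j) ` {i..n}"
  then obtain j where "t = a + real j" "i \<le> j" "j \<le> n"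
    by auto
  then show "t \<in> N_upto (a + real i) (a + real n)"
    by (auto simp: N_upto_def N_from_def intro!: exI[of _ "j - i"])
qed

lemma N_upto_shift_0: "N_upto a (a + real n) = (\<lambda>j. a + real j) ` {0..n}"
  using N_upto_shift[of a 0 n] by simp

lemma N_upto_shift_1: "N_upto (a + 1) (a + real n) = (\<lambda>j. a + real j) ` {1..n}"
  using N_upto_shift[of a 1 n] by simp

lemma N_upto_shift_2: "N_upto (a + 2) (a + real n) = (\<lambda>j. a + real j) ` {2..n}"
  using N_upto_shift[of a 2 n] by simp

lemma inj_shift: "inj_on (\<lambda>j. a + real j) A"
  by (simp add: inj_on_def)

text \<open>With base point a - 1 the fractional sum starts at s = a, that is at index 0, and is the
  product with (1 - z)^(\<alpha> - 2). Each nabla is a factor 1 - z; for m \<ge> 2 all indices it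
  reaches are natural numbers.\<close>

lemma nabla_diff_shift:
  assumes "1 < \<alpha>" "\<alpha> < 2" "m \<ge> 2"
  shows "nabla_diff (a - 1) \<alpha> u (a + real m)
    = fps_nth ((1 - fps_X)\<^sup>2 * gen_binomial_fps (2 - \<alpha>) * Abs_fps (\<lambda>j. u (a + real j))) m"
proof -
  let ?F = "gen_binomial_fps (2 - \<alpha>) * Abs_fps (\<lambda>j. u (a + real j))"
  have F: "nabla_sum (a - 1) (2 - \<alpha>) u (a + real i) = fps_nth ?F i" for i
  proof -
    have "nabla_sum (a - 1) (2 - \<alpha>) u (a + real i)
        = (\<Sum>j=0..i. nabla_taylor (1 - \<alpha>) (a + real i) (a + real j - 1) * u (a + real j))"
      by (simp add: nabla_sum_def N_upto_shift_0 sum.reindex inj_shift)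
    also have "\<dots> = (\<Sum>j=0..i. fps_nth (gen_binomial_fps (2 - \<alpha>)) (i - j) * u (a + real j))"
      using assms by (intro sum.cong)
        (auto simp: nabla_taylor_def fps_nth_gen_binomial of_nat_diff algebra_simps)
    also have "\<dots> = fps_nth (Abs_fps (\<lambda>j. u (a + real j)) * gen_binomial_fps (2 - \<alpha>)) i"
      unfolding fps_mult_nth by (intro sum.cong) auto
    finally show ?thesis
      by (simp add: mult.commute)
  qed
  obtain k where k: "m = k + 2"
    using \<open>m \<ge> 2\<close> le_Suc_ex by (metis add.commute)
  have sq: "(1 - fps_X)\<^sup>2 * G = G - fps_X * G - fps_X * G + fps_X * (fps_X * G)" for G :: "real fps"
    by (simp add: power2_eq_square algebra_simps)
  have "fps_nth ((1 - fps_X)\<^sup>2 * ?F) m = fps_nth ?F (k + 2) - 2 * fps_nth ?F (k + 1) + fps_nth ?F k"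
    unfolding sq k by (simp add: fps_X_mult_nth)
  moreover have "nabla_diff (a - 1) \<alpha> u (a + real m) = fps_nth ?F (k + 2) - 2 * fps_nth ?F (k + 1) + fps_nth ?F k"
  proof -
    have t: "a + real m - 1 = a + real (k + 1)" "a + real (k + 1) - 1 = a + real k"
      by (auto simp: k)
    show ?thesis
      unfolding nabla_diff_def nabla_def t F by (simp add: k)
  qed
  ultimately show ?thesis
    by (simp add: mult.assoc)
qed

text \<open>Both branches of \<open>green\<close> in one formula: for k < j the truncated difference
  \<open>k + 1 - j\<close> is 0, and \<open>rising 0 r = 0\<close> removes the subtracted
  term.\<close>

definition green_grid :: "nat \<Rightarrow> real \<Rightarrow> nat \<Rightarrow> nat \<Rightarrow> real" where
  "green_grid n \<alpha> k j = (rising (real (n + 1 - j)) (\<alpha> - 1) / rising (real n) (\<alpha> - 1) * rising (real k) (\<alpha> - 1)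
     - rising (real (k + 1 - j)) (\<alpha> - 1)) / Gamma \<alpha>"

lemma green_shift:
  assumes "j \<in> {1..n}" "k \<le> n"
  shows "green a (a + real n) \<alpha> (a + real k) (a + real j) = green_grid n \<alpha> k j"
proof -
  have e: "a + real j - 1 = a + real (j - 1)" "a + real n - (a + real j) + 1 = real (n + 1 - j)"
    using assms by auto
  have mem: "a + real k \<in> N_upto a (a + real j - 1) \<longleftrightarrow> k < j"
    unfolding e(1) N_upto_shift_0 using assms by (auto simp: image_iff)
  show ?thesis
  proof (cases "k < j")
    case True
    then show ?thesis
      unfolding green_def mem e(2) by (simp add: green_grid_def)
  next
    case False
    then have e3: "a + real k - (a + real j) + 1 = real (k + 1 - j)"
      by auto
    from False show ?thesis
      unfolding green_def mem e(2) e3 by (simp add: green_grid_def del: of_nat_diff)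
  qed
qed

lemma green_op_shift:
  assumes "k \<le> n"
  shows "green_op a (a + real n) \<alpha> f u1 u2 (a + real k)
    = (\<Sum>j=1..n. green_grid n \<alpha> k j * f (a + real j, u1 (a + real j), u2 (a + real j)))"
proof -
  have "a + real k \<in> N_upto a (a + real n)"
    using assms by (auto simp: N_upto_shift_0)
  then show ?thesis
    using assms by (simp add: green_op_def N_upto_shift_1 sum.reindex inj_shift green_shift)
qed

section \<open>Sign, boundary values and row sums of the kernel, and the solution formula\<close>

context
  fixes \<alpha> :: real and n :: nat
  assumes \<alpha>: "1 < \<alpha>" "\<alpha> < 2" and n: "n \<ge> 2"
begin

lemma green_grid_left: "j \<ge> 1 \<Longrightarrow> green_grid n \<alpha> 0 j = 0"
  by (simp add: green_grid_def)

lemma green_grid_right: "green_grid n \<alpha> n j = 0"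
  using \<alpha> n rising_pos[of "real n" "\<alpha> - 1"] by (simp add: green_grid_def)

text \<open>The quotient of equal \<open>rising\<close> values cancels. This matches a difference
  equation posed from index 2 on and lets sums over j start at 2.\<close>

lemma green_grid_first: "green_grid n \<alpha> k 1 = 0"
  using \<alpha> n rising_pos[of "real n" "\<alpha> - 1"] by (simp add: green_grid_def)

lemma green_grid_nonneg:
  assumes "j \<ge> 1" "k \<le> n"
  shows "green_grid n \<alpha> k j \<ge> 0"
proof -
  have pos: "rising (real n) (\<alpha> - 1) > 0"
    using \<alpha> n by (intro rising_pos) auto
  show ?thesis
  proof (cases "k < j")
    case True
    then show ?thesis
      using pos \<alpha> by (simp add: green_grid_def rising_of_nat_nonneg)
  next
    case False
    then have "k + 1 - j = k - (j - 1)" "n + 1 - j = n - (j - 1)"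
      using assms by auto
    then have "rising (real (k + 1 - j)) (\<alpha> - 1) * rising (real n) (\<alpha> - 1)
        \<le> rising (real (n + 1 - j)) (\<alpha> - 1) * rising (real k) (\<alpha> - 1)"
      using rising_quotient_mono[of "\<alpha> - 1" "j - 1" k n] \<alpha> assms False by simp
    then show ?thesis
      using pos \<alpha> by (simp add: green_grid_def field_simps)
  qed
qed

text \<open>In the last column \<open>rising 1 (\<alpha> - 1)\<close> cancels
  \<open>Gamma \<alpha>\<close>, the subtracted term is 0, and a quotient of two values of the
  monotone \<open>rising\<close> remains.\<close>

lemma green_grid_last_le: "k < n \<Longrightarrow> green_grid n \<alpha> k n \<le> 1"
  using \<alpha> n rising_pos[of "real n" "\<alpha> - 1"] rising_of_nat_mono[of "\<alpha> - 1" k n]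
  by (simp add: green_grid_def rising_1_left)

text \<open>Both parts of the kernel are summed by \<open>sum_rising\<close> after reversing the
  index. The term with \<open>Gamma (\<alpha> + 1) / rising (real n) (\<alpha> - 1)\<close> is the
  contribution of the omitted column j = n.\<close>

lemma sum_green_grid:
  assumes "k < n"
  shows "(\<Sum>j=1..<n. green_grid n \<alpha> k j)
    = rising (real k) (\<alpha> - 1) * (real n - real k - Gamma (\<alpha> + 1) / rising (real n) (\<alpha> - 1)) / Gamma (\<alpha> + 1)"
proof -
  define r where "r = \<alpha> - 1"
  define h where "h m = rising (real m) r" for m
  have r: "r > 0" and hn: "h n > 0" and G: "Gamma \<alpha> > 0" "Gamma (\<alpha> + 1) = \<alpha> * Gamma \<alpha>"
    using \<alpha> n by (auto simp: r_def h_def intro!: rising_pos Gamma_plus1_pos)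
  have rev: "(\<Sum>j=1..m. h (m + 1 - j)) = h m * (real m + r) / \<alpha>" for m
  proof -
    have "(\<Sum>j=1..m. h (m + 1 - j)) = (\<Sum>j=1..m. h j)"
      by (rule sum.reindex_bij_witness[of _ "\<lambda>j. m + 1 - j" "\<lambda>j. m + 1 - j"]) auto
    then show ?thesis
      using sum_rising[OF r, of m] by (simp add: h_def r_def)
  qed
  have s1: "(\<Sum>j=1..<n. h (n + 1 - j)) = h n * (real n + r) / \<alpha> - Gamma \<alpha>"
  proof -
    have "(\<Sum>j=1..n. h (n + 1 - j)) = (\<Sum>j=1..<n. h (n + 1 - j)) + h 1"
      using n by (simp flip: sum.last_plus atLeastLessThanSuc_atLeastAtMost)
    then show ?thesis
      using rev[of n] r by (simp add: h_def r_def rising_1_left)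
  qed
  have s2: "(\<Sum>j=1..<n. h (k + 1 - j)) = h k * (real k + r) / \<alpha>"
  proof -
    have "(\<Sum>j=1..<n. h (k + 1 - j)) = (\<Sum>j=1..k. h (k + 1 - j))"
      using assms by (intro sum.mono_neutral_right) (auto simp: h_def)
    then show ?thesis
      using rev[of k] by simp
  qed
  have "(\<Sum>j=1..<n. green_grid n \<alpha> k j)
      = (h k / h n * (\<Sum>j=1..<n. h (n + 1 - j)) - (\<Sum>j=1..<n. h (k + 1 - j))) / Gamma \<alpha>"
    unfolding sum_distrib_left sum_divide_distrib sum_subtractf[symmetric]
    by (intro sum.cong) (auto simp: green_grid_def h_def r_def)
  also have "\<dots> = h k * (real n - real k - Gamma (\<alpha> + 1) / h n) / Gamma (\<alpha> + 1)"
  proof -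
    have "h k / h n * (h n * (real n + r) / \<alpha> - Gamma \<alpha>) - h k * (real k + r) / \<alpha>
        = h k * (real n - real k - \<alpha> * Gamma \<alpha> / h n) / \<alpha>"
      using hn \<alpha> by (simp add: field_simps)
    then show ?thesis
      unfolding s1 s2 G(2) by simp
  qed
  finally show ?thesis
    by (simp add: h_def r_def)
qed

text \<open>The equations prescribe the coefficients of D * Y from index 2 on, where D has inverse
  (1 - z)^(-\<alpha>). Coefficient 0 is fixed by y 0 = 0, coefficient 1 is a free parameter, and y n
  = 0 determines it.\<close>

lemma green_grid_eq_iff:
  fixes y h :: "nat \<Rightarrow> real"
  shows "(\<forall>m\<in>{2..n}. fps_nth ((1 - fps_X)\<^sup>2 * gen_binomial_fps (2 - \<alpha>) * Abs_fps y) m + h m = 0)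
        \<and> y 0 = 0 \<and> y n = 0
    \<longleftrightarrow> (\<forall>k\<le>n. y k = (\<Sum>j=1..n. green_grid n \<alpha> k j * h j))"
    (is "?bvp \<longleftrightarrow> ?sol")
proof -
  define A where "A = gen_binomial_fps \<alpha>"
  define D where "D = (1 - fps_X)\<^sup>2 * gen_binomial_fps (2 - \<alpha>)"
  define p where "p m = rising (real m) (\<alpha> - 1) / Gamma \<alpha>" for m
  have DA: "D * A = 1" "A * D = 1"
    using gen_binomial_fps_mult[of "2 - \<alpha>" \<alpha>] gen_binomial_fps_2
    by (simp_all add: D_def A_def mult.assoc mult.commute[of "gen_binomial_fps \<alpha>"])
  have G: "Gamma \<alpha> > 0" and rn: "rising (real n) (\<alpha> - 1) > 0"
    using \<alpha> n by (auto intro!: rising_pos)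
  then have pn: "p n > 0"
    by (simp add: p_def)
  have p0: "p 0 = 0"
    by (simp add: p_def)
  have A: "fps_nth A m = p (m + 1)" for m
    using fps_nth_gen_binomial[of \<alpha> m] \<alpha> by (simp add: A_def p_def add.commute)
  \<comment> \<open>The right-hand side of D * Y = W, with the free coefficient c at index
    1.\<close>
  define W where "W c = Abs_fps (\<lambda>j. if j = 0 then 0 else if j = 1 then c else - h j)" for c
  have AW: "fps_nth (A * W c) k = c * p k - (\<Sum>j=2..n. p (k + 1 - j) * h j)" if "k \<le> n" for c k
  proof -
    have "fps_nth (A * W c) k = (\<Sum>j=0..k. fps_nth (W c) j * p (k + 1 - j))"
      unfolding mult.commute[of A] fps_mult_nth by (intro sum.cong) (auto simp: A Suc_diff_le)
    \<comment> \<open>Terms with j > k vanish because \<open>k + 1 - j = 0\<close> and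
      \<open>p 0 = 0\<close>, so one summation range serves all k.\<close>
    also have "\<dots> = (\<Sum>j\<le>n. fps_nth (W c) j * p (k + 1 - j))"
      using that by (intro sum.mono_neutral_left) (auto simp: p0)
    also have "{..n} = {0,1} \<union> {2..n}"
      using n by auto
    also have "(\<Sum>j\<in>{0,1} \<union> {2..n}. fps_nth (W c) j * p (k + 1 - j))
        = c * p k + (\<Sum>j=2..n. fps_nth (W c) j * p (k + 1 - j))"
      by (subst sum.union_disjoint) (auto simp: W_def)
    also have "(\<Sum>j=2..n. fps_nth (W c) j * p (k + 1 - j)) = (\<Sum>j=2..n. - (p (k + 1 - j) * h j))"
      by (intro sum.cong) (auto simp: W_def)
    finally show ?thesis
      by (simp add: sum_negf)
  qed
  \<comment> \<open>The value of c forced by y n = 0.\<close>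
  define c0 where "c0 = (\<Sum>j=2..n. p (n + 1 - j) * h j) / p n"
  have green: "(\<Sum>j=1..n. green_grid n \<alpha> k j * h j) = c0 * p k - (\<Sum>j=2..n. p (k + 1 - j) * h j)" for k
  proof -
    have "(\<Sum>j=1..n. green_grid n \<alpha> k j * h j) = (\<Sum>j=2..n. green_grid n \<alpha> k j * h j)"
      using n green_grid_first[of k] by (simp add: sum.atLeast_Suc_atMost numeral_2_eq_2)
    also have "\<dots> = (\<Sum>j=2..n. p (n + 1 - j) * h j / p n * p k - p (k + 1 - j) * h j)"
      using G rn by (intro sum.cong) (auto simp: green_grid_def p_def field_simps)
    finally show ?thesis
      by (simp add: c0_def sum_subtractf sum_distrib_right sum_divide_distrib)
  qed
  show ?thesis
    unfolding green D_def[symmetric]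
  proof
    assume L: "(\<forall>m\<in>{2..n}. fps_nth (D * Abs_fps y) m + h m = 0) \<and> y 0 = 0 \<and> y n = 0"
    define c where "c = fps_nth (D * Abs_fps y) 1"
    have W: "fps_nth (D * Abs_fps y) i = fps_nth (W c) i" if i: "i \<le> n" for i
    proof -
      consider "i = 0" | "i = 1" | "i \<in> {2..n}"
        by atomize_elim (use i in auto)
      then show ?thesis
      proof cases
        case 3
        then have "fps_nth (D * Abs_fps y) i = - h i"
          using L by (simp add: add_eq_0_iff)
        with 3 show ?thesis
          by (simp add: W_def)
      qed (use L in \<open>auto simp: W_def c_def\<close>)
    qed
    have y: "y k = c * p k - (\<Sum>j=2..n. p (k + 1 - j) * h j)" if "k \<le> n" for k
    proof -
      have "y k = fps_nth (A * (D * Abs_fps y)) k"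
        by (simp add: mult.assoc[symmetric] DA)
      also have "\<dots> = fps_nth (A * W c) k"
        using W that by (intro fps_nth_cong_mult) auto
      finally show ?thesis
        using AW[OF that] by simp
    qed
    have "c = c0"
      using y[of n] L pn by (simp add: c0_def field_simps)
    with y show "\<forall>k\<le>n. y k = c0 * p k - (\<Sum>j=2..n. p (k + 1 - j) * h j)"
      by blast
  next
    assume R: "\<forall>k\<le>n. y k = c0 * p k - (\<Sum>j=2..n. p (k + 1 - j) * h j)"
    have "fps_nth (D * Abs_fps y) m + h m = 0" if "m \<in> {2..n}" for m
    proof -
      have "fps_nth (D * Abs_fps y) m = fps_nth (D * (A * W c0)) m"
        using R AW that by (intro fps_nth_cong_mult) auto
      also have "\<dots> = - h m"
        using that by (simp add: mult.assoc[symmetric] DA W_def)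
      finally show ?thesis
        by simp
    qed
    moreover have "y 0 = 0"
    proof -
      have "(\<Sum>j=2..n. p (0 + 1 - j) * h j) = 0"
        by (intro sum.neutral) (auto simp: p0)
      then show ?thesis
        using R by (simp add: p0)
    qed
    moreover have "y n = 0"
      using R pn by (simp add: c0_def)
    ultimately show "(\<forall>m\<in>{2..n}. fps_nth (D * Abs_fps y) m + h m = 0) \<and> y 0 = 0 \<and> y n = 0"
      by blast
  qed
qed

end

section \<open>Row sums of the Green's function\<close>

text \<open>
  \<open>x\<close> is the point where \<open>(n - x) * rising x r\<close> agrees with its value at \<open>x - 1\<close>. It need not be a
  grid point, and without the term \<open>Gamma (r + 2) / rising n r\<close> the bound fails in general.
\<close>

lemma rising_peak_bound:
  assumes r: "0 < r" "r < 1" and k: "1 \<le> k" "k < n"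
    and x: "x = (r * real n + 1) / (1 + r)"
  shows "rising (real k) r * (real n - real k - Gamma (r + 2) / rising (real n) r) \<le> (real n - x) * rising x r"
proof -
  define h where "h m = rising (real m) r" for m
  define c where "c = Gamma (r + 2) / h n"
  have n: "n \<ge> 2"
    using k by simp
  have hpos: "h m > 0" if "m \<ge> 1" for m
    using that r by (auto simp: h_def intro!: rising_pos)
  have hstep: "h (m + 1) = h m * (real m + r) / real m" if "m \<ge> 1" for m
    using rising_plus1[of "real m" r] that r by (simp add: h_def add.commute)
  have hmono: "h i \<le> h j" if "i \<le> j" for i j
    unfolding h_def using rising_of_nat_mono that r by simp
  have G: "Gamma (r + 2) = (r + 1) * Gamma (r + 1)" "Gamma (r + 1) > 0"
    using Gamma_plus1_pos[of "r + 1"] r by (auto simp: add_ac)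
  \<comment> \<open>The correction from the omitted last column must not be too small; the linear
    upper bound on \<open>h n\<close> guarantees this.\<close>
  have c: "c \<ge> (1 + r) / (1 + r * (real n - 1))"
  proof -
    define X where "X = 1 + r * (real n - 1)"
    have "h n \<le> Gamma (r + 1) * X"
      using rising_of_nat_upper[of r n] r n by (simp add: h_def X_def)
    moreover have "X > 0"
      using r n by (simp add: X_def add_pos_nonneg)
    ultimately have "1 / X \<le> Gamma (r + 1) / h n"
      using hpos[of n] n by (simp add: field_simps)
    then have "(1 + r) * (1 / X) \<le> (1 + r) * (Gamma (r + 1) / h n)"
      using r by (intro mult_left_mono) auto
    then show ?thesis
      by (simp add: c_def G X_def add.commute)
  qed
  have c0: "c \<ge> 0"
    using hpos[of n] n G r by (simp add: c_def)
  \<comment> \<open>The peak equation: it says that \<open>(n - x) * rising x r\<close> equals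
    \<open>(n - x + 1) * rising (x - 1) r\<close>.\<close>
  have xr: "r * (real n - x) = x - 1"
    unfolding x using r by (simp add: field_simps)
  have x1: "x \<ge> 1" and xn: "x \<le> real n"
    unfolding x using r n by (auto simp: field_simps)
  define K where "K = nat \<lfloor>x\<rfloor>"
  have K: "real K \<le> x" "x < real K + 1" "K \<ge> 1"
    using x1 by (auto simp: K_def le_nat_iff)
  define \<theta> where "\<theta> = x - real K"
  have \<theta>: "0 \<le> \<theta>" "\<theta> \<le> 1" "x = real K + \<theta>"
    using K by (auto simp: \<theta>_def)
  have KX: "r * (real n - (real K + \<theta>)) = real K + \<theta> - 1"
    using xr \<theta> by simp
  \<comment> \<open>Interpolating from K up to x loses \<theta> (1 - \<theta>) / K, at most 1 / (4
    K), and the correction c absorbs this loss.\<close>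
  have at_floor: "h K * (real n - real K - c) \<le> (real n - x) * rising x r"
  proof -
    have "(real n - x) * (h K * (1 + \<theta> * r / real K)) \<le> (real n - x) * rising x r"
      using rising_interpolation[of "real K" \<theta> r] \<theta> r K xn by (intro mult_left_mono) (auto simp: h_def)
    moreover have "h K * (real n - real K - c) \<le> h K * ((real n - x) * (1 + \<theta> * r / real K))"
    proof (rule mult_left_mono)
      have "(real n - x) * (1 + \<theta> * r / real K) = real n - real K - \<theta> + \<theta> * (r * (real n - x)) / real K"
        using \<theta> K by (simp add: field_simps)
      also have "\<dots> = real n - real K - \<theta> * (1 - \<theta>) / real K"
        unfolding xr using K by (simp add: \<theta> field_simps)
      finally have eq: "(real n - x) * (1 + \<theta> * r / real K) = real n - real K - \<theta> * (1 - \<theta>) / real K" .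
      have "\<theta> * (1 - \<theta>) \<le> 1 / 4"
        using zero_le_power2[of "2 * \<theta> - 1"] by (simp add: power2_eq_square algebra_simps)
      then have "\<theta> * (1 - \<theta>) / real K \<le> 1 / 4 / real K"
        by (rule divide_right_mono) simp
      also have "\<dots> \<le> (1 + r) / (1 + r * (real n - 1))"
      proof -
        have "r * real n + 1 = x * (1 + r)"
          unfolding x using r by simp
        \<comment> \<open>Since K \<ge> 1, x < K + 1 \<le> 2 K.\<close>
        also have "\<dots> \<le> 4 * real K * (1 + r)"
          using K r by (intro mult_right_mono) auto
        finally have "1 + r * (real n - 1) \<le> 4 * real K * (1 + r)"
          using r by (simp add: algebra_simps)
        moreover have "1 + r * (real n - 1) > 0"
          using r n by (simp add: add_pos_nonneg)
        ultimately show ?thesis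
          using K by (simp add: field_simps)
      qed
      finally show "real n - real K - c \<le> (real n - x) * (1 + \<theta> * r / real K)"
        using eq c by linarith
    qed (use hpos K in \<open>auto intro: less_imp_le\<close>)
    ultimately show ?thesis
      by (simp add: mult_ac)
  qed
  \<comment> \<open>Left of K the correction is dropped. The values increase up to K - 1, which is
    then compared with x - 1 instead of K: interpolation leads from K - 1 to x - 1, and the peak
    equation moves on to x without loss.\<close>
  have below: "h m * (real n - real m) \<le> (real n - x) * rising x r" if m: "1 \<le> m" "m < K" for m
    using m
  proof (induction "K - m" arbitrary: m)
    case (Suc d)
    show ?case
    proof (cases "Suc m = K")
      case True
      have mK: "real K = real m + 1"
        using True by auto
      have m0: "real m > 0"
        using Suc by simp
      have pos: "real m + \<theta> > 0" "real n - x \<ge> 0"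
        using m0 \<theta> xn by auto
      have "real n - real m \<le> (real n - x + 1) * (1 + \<theta> * r / real m)"
      proof -
        have "(real n - x + 1) * (1 + \<theta> * r / real m) = real n - real m - \<theta> + \<theta> * (r * (real n - x) + r) / real m"
          using \<theta> mK m0 by (simp add: field_simps)
        also have "\<dots> = real n - real m + \<theta> * (\<theta> + r) / real m"
          unfolding xr using m0 by (simp add: \<theta> mK field_simps)
        finally show ?thesis
          using \<theta> r by simp
      qed
      then have "h m * (real n - real m) \<le> h m * ((real n - x + 1) * (1 + \<theta> * r / real m))"
        using hpos[of m] Suc.prems by (intro mult_left_mono) auto
      also have "\<dots> = (real n - x + 1) * (h m * (1 + \<theta> * r / real m))"
        by simp
      also have "\<dots> \<le> (real n - x + 1) * rising (real m + \<theta>) r"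
        using rising_interpolation[of "real m" \<theta> r] \<theta> r m0 pos by (intro mult_left_mono) (auto simp: h_def)
      also have "\<dots> = (real n - x) * rising x r"
      proof -
        have xm: "x = real m + \<theta> + 1"
          using \<theta> mK by simp
        have eq: "(real n - x) * (real m + \<theta> + r) = (real n - x + 1) * (real m + \<theta>)"
          using xr xm by (simp add: algebra_simps)
        have "rising x r = rising (real m + \<theta>) r * (real m + \<theta> + r) / (real m + \<theta>)"
          unfolding xm using pos r by (intro rising_plus1) auto
        then have "(real n - x) * rising x r
            = rising (real m + \<theta>) r * ((real n - x) * (real m + \<theta> + r)) / (real m + \<theta>)"
          by simp
        also have "\<dots> = (real n - x + 1) * rising (real m + \<theta>) r"
          unfolding eq using pos by simp
        finally show ?thesis
          by simp
      qed
      finally show ?thesis .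
    next
      case False
      \<comment> \<open>As m + 1 \<le> K \<le> x, the step from m to m + 1 still lies on the
        increasing side of the peak.\<close>
      have m0: "real m > 0" and mK: "real m + 1 \<le> real K"
        using Suc by auto
      have "(1 + r) * (real m + 1) \<le> (1 + r) * x"
        using mK K r by (intro mult_left_mono) auto
      also have "\<dots> = r * real n + 1"
        unfolding x using r by simp
      finally have "(real n - real m) * real m \<le> (real n - real m - 1) * (real m + r)"
        by (simp add: algebra_simps)
      then have "real n - real m \<le> (real m + r) / real m * (real n - real (m + 1))"
        using m0 by (simp add: field_simps)
      then have "h m * (real n - real m) \<le> h m * ((real m + r) / real m * (real n - real (m + 1)))"
        using hpos[of m] Suc.prems by (intro mult_left_mono) auto
      also have "\<dots> = h (m + 1) * (real n - real (m + 1))"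
        using hstep[of m] Suc.prems by simp
      also have "\<dots> \<le> (real n - x) * rising x r"
        using Suc False by (intro Suc.hyps) auto
      finally show ?thesis .
    qed
  qed simp
  have "h k * (real n - real k - c) \<le> (real n - x) * rising x r"
  proof (cases "k < K")
    case True
    have "h k * (real n - real k - c) \<le> h k * (real n - real k)"
      using c0 hpos[of k] k by (intro mult_left_mono) auto
    with below[of k] True k show ?thesis
      by simp
  next
    case False
    then have "K \<le> k"
      by simp
    \<comment> \<open>From K on, x \<le> m + 1 makes \<open>h m * (n - m)\<close> decrease, while
      \<open>h m * c\<close> increases, so the difference is largest at K.\<close>
    then have "h k * (real n - real k) - h k * c \<le> h K * (real n - real K) - h K * c"
    proof (induction k rule: dec_induct)
      case (step m)
      have m0: "real m > 0" and mx: "x \<le> real m + 1"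
        using step K by auto
      have "r * real n + 1 = (1 + r) * x"
        unfolding x using r by simp
      also have "\<dots> \<le> (1 + r) * (real m + 1)"
        using mx r by (intro mult_left_mono) auto
      finally have "(real n - real m - 1) * (real m + r) \<le> (real n - real m) * real m"
        by (simp add: algebra_simps)
      then have "(real m + r) / real m * (real n - real (Suc m)) \<le> real n - real m"
        using m0 by (simp add: field_simps)
      then have "h m * ((real m + r) / real m * (real n - real (Suc m))) \<le> h m * (real n - real m)"
        using hpos[of m] m0 by (intro mult_left_mono) auto
      moreover have "h (Suc m) = h m * (real m + r) / real m"
        using hstep[of m] m0 by simp
      ultimately have "h (Suc m) * (real n - real (Suc m)) \<le> h m * (real n - real m)"
        by simp
      moreover have "h m * c \<le> h (Suc m) * c"
        using hmono[of m "Suc m"] c0 by (intro mult_right_mono) auto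
      ultimately show ?case
        using step.IH by linarith
    qed simp
    then show ?thesis
      using at_floor by (simp add: algebra_simps)
  qed
  then show ?thesis
    by (simp add: h_def c_def)
qed

text \<open>The peak bound with r = \<alpha> - 1: its point x is the argument of
  \<open>rising\<close> in \<open>green_const\<close>, and n - x = (n - 1) / \<alpha> supplies the
  prefactor.\<close>

lemma sum_green_grid_le_green_const:
  assumes \<alpha>: "1 < \<alpha>" "\<alpha> < 2" and k: "1 \<le> k" "k < n"
  shows "(\<Sum>j=1..<n. green_grid n \<alpha> k j) \<le> green_const a (a + real n) \<alpha>"
proof -
  define x where "x = ((\<alpha> - 1) * real n + 1) / \<alpha>"
  have G: "Gamma (\<alpha> + 1) > 0"
    using \<alpha> by simp
  have "rising (real k) (\<alpha> - 1) * (real n - real k - Gamma (\<alpha> - 1 + 2) / rising (real n) (\<alpha> - 1))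
      \<le> (real n - x) * rising x (\<alpha> - 1)"
    using \<alpha> k by (intro rising_peak_bound) (auto simp: x_def)
  moreover have "real n - x = (real n - 1) / \<alpha>"
    using \<alpha> by (simp add: x_def field_simps)
  moreover have "\<alpha> - 1 + 2 = \<alpha> + 1"
    by simp
  ultimately have "rising (real k) (\<alpha> - 1) * (real n - real k - Gamma (\<alpha> + 1) / rising (real n) (\<alpha> - 1)) / Gamma (\<alpha> + 1)
      \<le> (real n - 1) / \<alpha> * rising x (\<alpha> - 1) / Gamma (\<alpha> + 1)"
    using G by (intro divide_right_mono) auto
  then show ?thesis
    using sum_green_grid[of \<alpha> n k] \<alpha> k by (simp add: green_const_def x_def)
qed

lemma green_const_pos:
  assumes "1 < \<alpha>" "n \<ge> 2"
  shows "green_const a (a + real n) \<alpha> > 0"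
proof -
  have "((\<alpha> - 1) * real n + 1) / \<alpha> > 0"
    using assms by (auto intro!: divide_pos_pos add_nonneg_pos)
  then have "rising (((\<alpha> - 1) * real n + 1) / \<alpha>) (\<alpha> - 1) > 0"
    using assms by (intro rising_pos) auto
  then show ?thesis
    using assms unfolding green_const_def by (auto intro!: mult_pos_pos divide_pos_pos)
qed

section \<open>Contraction and stability\<close>

text \<open>The nonlinearity enters only through its values along u1 and u2, so the linear
  equivalence applies with these as a source term. Membership in \<open>grid_space\<close> turns
  agreement on the grid into equality of functions.\<close>

lemma bvp_iff_green_op:
  assumes \<alpha>: "1 < \<alpha>" "\<alpha> < 2" and n: "n \<ge> 2" and u: "u \<in> grid_space a (a + real n)"
  shows "(\<forall>t\<in>N_upto (a + 2) (a + real n). nabla_diff (a - 1) \<alpha> u t + f (t, u1 t, u2 t) = 0)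
        \<and> u a = 0 \<and> u (a + real n) = 0
    \<longleftrightarrow> u = green_op a (a + real n) \<alpha> f u1 u2"
proof -
  have "u = green_op a (a + real n) \<alpha> f u1 u2
      \<longleftrightarrow> (\<forall>t\<in>N_upto a (a + real n). u t = green_op a (a + real n) \<alpha> f u1 u2 t)"
    using u by (auto simp: grid_space_def green_op_def fun_eq_iff)
  also have "\<dots> \<longleftrightarrow> (\<forall>k\<le>n. u (a + real k)
      = (\<Sum>j=1..n. green_grid n \<alpha> k j * f (a + real j, u1 (a + real j), u2 (a + real j))))"
    by (auto simp: N_upto_shift_0 green_op_shift)
  finally show ?thesis
    using green_grid_eq_iff[OF \<alpha> n, of "\<lambda>k. u (a + real k)" "\<lambda>j. f (a + real j, u1 (a + real j), u2 (a + real j))"]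
    by (simp add: N_upto_shift_2 nabla_diff_shift[OF \<alpha>])
qed

lemma coupled_bvp_iff_green_op:
  assumes "1 < \<alpha>1" "\<alpha>1 < 2" "1 < \<alpha>2" "\<alpha>2 < 2" "n \<ge> 2"
    and "u1 \<in> grid_space a (a + real n)" "u2 \<in> grid_space a (a + real n)"
  shows "coupled_bvp a (a + real n) \<alpha>1 \<alpha>2 f1 f2 u1 u2
    \<longleftrightarrow> u1 = green_op a (a + real n) \<alpha>1 f1 u1 u2 \<and> u2 = green_op a (a + real n) \<alpha>2 f2 u1 u2"
  unfolding coupled_bvp_def
  using bvp_iff_green_op[of \<alpha>1 n u1 a f1 u1 u2] bvp_iff_green_op[of \<alpha>2 n u2 a f2 u1 u2] assms by blast

text \<open>Picard iteration from 0 in the maximum norm over I. Only coordinates in I are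
  controlled, so distances are expressed by bounds d and the fixed-point equation is claimed on I
  alone.\<close>

lemma finite_sup_contraction_fixpoint:
  fixes F :: "('i \<Rightarrow> real) \<Rightarrow> 'i \<Rightarrow> real"
  assumes fin: "finite I" and q: "0 \<le> q" "q < 1"
    and contr: "\<And>u v d i. i \<in> I \<Longrightarrow> d \<ge> 0 \<Longrightarrow> (\<And>j. j \<in> I \<Longrightarrow> \<bar>u j - v j\<bar> \<le> d) \<Longrightarrow> \<bar>F u i - F v i\<bar> \<le> q * d"
  shows "\<exists>u. \<forall>i\<in>I. u i = F u i"
proof -
  define x where "x n = (F ^^ n) (\<lambda>_. 0)" for n
  define d where "d = (\<Sum>j\<in>I. \<bar>x 1 j - x 0 j\<bar>)"
  have xS: "x (Suc n) = F (x n)" for n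
    by (simp add: x_def)
  have d: "d \<ge> 0"
    by (simp add: d_def sum_nonneg)
  have diff: "\<bar>x (Suc n) i - x n i\<bar> \<le> q ^ n * d" if "i \<in> I" for n i
    using that
  proof (induction n arbitrary: i)
    case 0
    then show ?case
      using fin member_le_sum[of i I "\<lambda>j. \<bar>x 1 j - x 0 j\<bar>"] by (simp add: d_def)
  next
    case (Suc n)
    then show ?case
      using contr[of i "q ^ n * d" "x (Suc n)" "x n"] q d by (simp add: xS)
  qed
  have conv: "convergent (\<lambda>n. x n i)" if "i \<in> I" for i
  proof -
    have "summable (\<lambda>n. x (Suc n) i - x n i)"
    proof (rule summable_comparison_test')
      show "summable (\<lambda>n. q ^ n * d)"
        using q by (intro summable_mult2 summable_geometric) simp
      show "norm (x (Suc n) i - x n i) \<le> q ^ n * d" if "n \<ge> 0" for n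
        using diff \<open>i \<in> I\<close> by simp
    qed
    then have "convergent (\<lambda>n. x n i - x 0 i)"
      by (simp add: summable_iff_convergent sum_lessThan_telescope[where f = "\<lambda>n. x n i"])
    then show ?thesis
      using convergent_add[of _ "\<lambda>_. x 0 i"] by (fastforce simp: convergent_const)
  qed
  define u where "u i = lim (\<lambda>n. x n i)" for i
  have lim: "(\<lambda>n. x n i) \<longlonglongrightarrow> u i" if "i \<in> I" for i
    using conv[OF that] by (simp add: u_def convergent_LIMSEQ_iff)
  have "F u i = u i" if i: "i \<in> I" for i
  proof -
    \<comment> \<open>The finite sum dominates every coordinate distance and tends to 0, so F
      applied to the iterates converges to F u.\<close>
    have "(\<lambda>n. q * (\<Sum>j\<in>I. \<bar>x n j - u j\<bar>)) \<longlonglongrightarrow> q * (\<Sum>j\<in>I. \<bar>u j - u j\<bar>)"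
      by (intro tendsto_intros lim)
    then have bound: "(\<lambda>n. q * (\<Sum>j\<in>I. \<bar>x n j - u j\<bar>)) \<longlonglongrightarrow> 0"
      by simp
    have "norm (x (Suc n) i - F u i) \<le> q * (\<Sum>j\<in>I. \<bar>x n j - u j\<bar>)" for n
      unfolding xS real_norm_def
    proof (rule contr[OF i])
      show "0 \<le> (\<Sum>j\<in>I. \<bar>x n j - u j\<bar>)"
        by (simp add: sum_nonneg)
      show "\<bar>x n k - u k\<bar> \<le> (\<Sum>j\<in>I. \<bar>x n j - u j\<bar>)" if "k \<in> I" for k
        using fin that by (intro member_le_sum) auto
    qed
    then have "(\<lambda>n. x (Suc n) i - F u i) \<longlonglongrightarrow> 0"
      by (intro Lim_null_comparison[OF always_eventually bound] allI)
    then have "(\<lambda>n. x (Suc n) i) \<longlonglongrightarrow> F u i"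
      by (rule LIM_zero_cancel)
    then show ?thesis
      using LIMSEQ_Suc[OF lim[OF i]] LIMSEQ_unique by blast
  qed
  then show ?thesis
    by (intro exI[of _ u]) simp
qed

lemma grid_norm_le_iff:
  "grid_norm a (a + real n) u \<le> c \<longleftrightarrow> (\<forall>k\<le>n. \<bar>u (a + real k)\<bar> \<le> c)"
  unfolding grid_norm_def N_upto_shift_0 by (subst Max_le_iff) auto

text \<open>
  The images of the operator vanish at both end points, so only differences at interior points
  need to be contracted. The last column of the kernel carries the end point difference \<open>e\<close>.
\<close>

lemma green_op_diff_le:
  assumes \<alpha>: "1 < \<alpha>" "\<alpha> < 2" and k: "1 \<le> k" "k < n"
    and K: "K \<ge> 0" "K' \<ge> 0"
    and lip: "\<And>t x1 x2 y1 y2. t \<in> N_upto (a + 1) (a + real n) \<Longrightarrow>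
       \<bar>f (t, x1, x2) - f (t, y1, y2)\<bar> \<le> K * \<bar>x1 - y1\<bar> + K' * \<bar>x2 - y2\<bar>"
    and int: "\<And>j. 1 \<le> j \<Longrightarrow> j < n \<Longrightarrow> \<bar>u1 (a + real j) - v1 (a + real j)\<bar> \<le> d"
             "\<And>j. 1 \<le> j \<Longrightarrow> j < n \<Longrightarrow> \<bar>u2 (a + real j) - v2 (a + real j)\<bar> \<le> d"
    and last: "\<bar>u1 (a + real n) - v1 (a + real n)\<bar> \<le> e" "\<bar>u2 (a + real n) - v2 (a + real n)\<bar> \<le> e"
  shows "\<bar>green_op a (a + real n) \<alpha> f u1 u2 (a + real k) - green_op a (a + real n) \<alpha> f v1 v2 (a + real k)\<bar>
    \<le> green_const a (a + real n) \<alpha> * (K + K') * d + (K + K') * e"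
proof -
  define D where "D j = f (a + real j, u1 (a + real j), u2 (a + real j)) - f (a + real j, v1 (a + real j), v2 (a + real j))" for j
  have n: "n \<ge> 2"
    using k by simp
  have d: "d \<ge> 0"
    using int(1)[OF k] by linarith
  have e: "e \<ge> 0"
    using last(1) by linarith
  have D: "\<bar>D j\<bar> \<le> (K + K') * c"
    if "1 \<le> j" "j \<le> n" "\<bar>u1 (a + real j) - v1 (a + real j)\<bar> \<le> c" "\<bar>u2 (a + real j) - v2 (a + real j)\<bar> \<le> c" for j c
  proof -
    have "\<bar>D j\<bar> \<le> K * \<bar>u1 (a + real j) - v1 (a + real j)\<bar> + K' * \<bar>u2 (a + real j) - v2 (a + real j)\<bar>"
      unfolding D_def using that by (intro lip) (auto simp: N_upto_shift_1)
    also have "\<dots> \<le> K * c + K' * c"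
      using that K by (intro add_mono mult_left_mono) auto
    finally show ?thesis
      by (simp add: algebra_simps)
  qed
  have g: "green_grid n \<alpha> k j \<ge> 0" if "j \<ge> 1" for j
    using green_grid_nonneg[OF \<alpha> n that] k by simp
  have "green_op a (a + real n) \<alpha> f u1 u2 (a + real k) - green_op a (a + real n) \<alpha> f v1 v2 (a + real k)
      = (\<Sum>j=1..n. green_grid n \<alpha> k j * D j)"
    using k by (simp add: green_op_shift D_def right_diff_distrib sum_subtractf)
  also have "\<bar>\<dots>\<bar> \<le> (\<Sum>j=1..n. \<bar>green_grid n \<alpha> k j * D j\<bar>)"
    by (rule sum_abs)
  also have "\<dots> = (\<Sum>j=1..<n. green_grid n \<alpha> k j * \<bar>D j\<bar>) + green_grid n \<alpha> k n * \<bar>D n\<bar>"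
    using n g by (simp add: abs_mult flip: sum.last_plus atLeastLessThanSuc_atLeastAtMost)
  also have "\<dots> \<le> (\<Sum>j=1..<n. green_grid n \<alpha> k j * ((K + K') * d)) + 1 * ((K + K') * e)"
    using g int last n K d e green_grid_last_le[OF \<alpha> n] k
    by (intro add_mono sum_mono mult_left_mono mult_mono D) auto
  also have "\<dots> = (\<Sum>j=1..<n. green_grid n \<alpha> k j) * ((K + K') * d) + (K + K') * e"
    by (simp add: sum_distrib_right)
  also have "\<dots> \<le> green_const a (a + real n) \<alpha> * ((K + K') * d) + (K + K') * e"
    using sum_green_grid_le_green_const[OF \<alpha> k] K d e by (intro add_mono mult_right_mono) auto
  finally show ?thesis
    by (simp add: mult.assoc)
qed

text \<open>Increments (1, 0) and (0, 1) isolate the two constants.\<close>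

lemma lipschitz_const_nonneg:
  fixes g :: "real \<times> real \<Rightarrow> real"
  assumes "\<And>x1 x2 y1 y2. \<bar>g (x1, x2) - g (y1, y2)\<bar> \<le> K * \<bar>x1 - y1\<bar> + K' * \<bar>x2 - y2\<bar>"
  shows "K \<ge> 0" "K' \<ge> 0"
proof -
  have "0 \<le> \<bar>g (1, 0) - g (0, 0)\<bar>" "0 \<le> \<bar>g (0, 1) - g (0, 0)\<bar>"
    by simp_all
  then show "K \<ge> 0" "K' \<ge> 0"
    using assms[of 1 0 0 0] assms[of 0 1 0 0] by auto
qed

lemma green_op_boundary:
  assumes "1 < \<alpha>" "\<alpha> < 2" "n \<ge> 2"
  shows "green_op a (a + real n) \<alpha> f u1 u2 a = 0" "green_op a (a + real n) \<alpha> f u1 u2 (a + real n) = 0"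
  using green_op_shift[of 0 n a \<alpha> f u1 u2] green_op_shift[of n n a \<alpha> f u1 u2] green_grid_left[OF assms]
    green_grid_right[OF assms] by simp_all

theorem theorem4p3:
  fixes a b \<alpha>1 \<alpha>2 L1 L2 L3 L4 M1 M2 lam1 lam2 R :: real
    and f1 f2 :: "real \<times> real \<times> real \<Rightarrow> real"
  assumes "b - a \<in> N_from 2"
    and "1 < \<alpha>1" "\<alpha>1 < 2" "1 < \<alpha>2" "\<alpha>2 < 2"
    and "continuous_on (N_upto (a + 1) b \<times> UNIV) f1"
    and "continuous_on (N_upto (a + 1) b \<times> UNIV) f2"
    and "\<And>t u1 u2 v1 v2. t \<in> N_upto (a + 1) b \<Longrightarrow>
           \<bar>f1 (t, u1, u2) - f1 (t, v1, v2)\<bar> \<le> L1 * \<bar>u1 - v1\<bar> + L2 * \<bar>u2 - v2\<bar>"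
    and "\<And>t u1 u2 v1 v2. t \<in> N_upto (a + 1) b \<Longrightarrow>
           \<bar>f2 (t, u1, u2) - f2 (t, v1, v2)\<bar> \<le> L3 * \<bar>u1 - v1\<bar> + L4 * \<bar>u2 - v2\<bar>"
    and "M1 = Max ((\<lambda>t. \<bar>f1 (t, 0, 0)\<bar>) ` N_upto (a + 1) b)"
    and "M2 = Max ((\<lambda>t. \<bar>f2 (t, 0, 0)\<bar>) ` N_upto (a + 1) b)"
    and "lam1 = green_const a b \<alpha>1" "lam2 = green_const a b \<alpha>2"
    and "lam1 * (L1 + L2) + lam2 * (L3 + L4) \<in> {0<..<1}"
    and "R \<ge> (lam1 * M1 + lam2 * M2) / (1 - (lam1 * (L1 + L2) + lam2 * (L3 + L4)))"
    and "spectral_radius (map_mat complex_of_real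
           (mat_of_rows_list 2 [[lam1 * L1, lam1 * L2], [lam2 * L3, lam2 * L4]])) < 1"
  shows "(\<forall>u1\<in>grid_space a b. \<forall>u2\<in>grid_space a b.
            coupled_bvp a b \<alpha>1 \<alpha>2 f1 f2 u1 u2 \<longleftrightarrow>
            u1 = green_op a b \<alpha>1 f1 u1 u2 \<and> u2 = green_op a b \<alpha>2 f2 u1 u2) \<and>
         ulam_hyers_stable (grid_space a b) (grid_norm a b)
           (green_op a b \<alpha>1 f1) (green_op a b \<alpha>2 f2)"
proof -
  obtain n where b: "b = a + real n" and n: "n \<ge> 2"
    using N_from_2_cases[OF assms(1)] .
  note \<alpha>1 = assms(2,3) and \<alpha>2 = assms(4,5)
  note lip1 = assms(8)[unfolded b] and lip2 = assms(9)[unfolded b]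
  let ?T1 = "green_op a (a + real n) \<alpha>1 f1" and ?T2 = "green_op a (a + real n) \<alpha>2 f2"
  have "a + 1 \<in> N_upto (a + 1) (a + real n)"
    using n by (auto simp: N_upto_shift_1 image_iff intro!: bexI[of _ 1])
  note lip_at = lip1[OF this] lip2[OF this]
  have L: "L1 \<ge> 0" "L2 \<ge> 0" "L3 \<ge> 0" "L4 \<ge> 0"
    using lipschitz_const_nonneg[of "\<lambda>p. f1 (a + 1, p)", OF lip_at(1)]
      lipschitz_const_nonneg[of "\<lambda>p. f2 (a + 1, p)", OF lip_at(2)] by simp_all
  have lam: "lam1 > 0" "lam2 > 0"
    using green_const_pos \<alpha>1 \<alpha>2 n by (auto simp: assms(12,13) b)
  define q where "q = lam1 * (L1 + L2) + lam2 * (L3 + L4)"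
  have q: "0 < q" "q < 1"
    using assms(14) by (auto simp: q_def)
  \<comment> \<open>Each component alone contracts by q when distances are measured by the larger of
    the two components.\<close>
  have q1: "lam1 * (L1 + L2) \<le> q" and q2: "lam2 * (L3 + L4) \<le> q"
    using lam L by (auto simp: q_def)
  define S where "S = L1 + L2 + L3 + L4"
  have S: "S \<ge> 0" "L1 + L2 \<le> S" "L3 + L4 \<le> S"
    using L by (auto simp: S_def)
  have contr: "\<bar>?T1 u1 u2 (a + real k) - ?T1 v1 v2 (a + real k)\<bar> \<le> q * d + S * e"
              "\<bar>?T2 u1 u2 (a + real k) - ?T2 v1 v2 (a + real k)\<bar> \<le> q * d + S * e"
    if k: "1 \<le> k" "k < n"
      and int: "\<And>j. 1 \<le> j \<Longrightarrow> j < n \<Longrightarrow> \<bar>u1 (a + real j) - v1 (a + real j)\<bar> \<le> d"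
             "\<And>j. 1 \<le> j \<Longrightarrow> j < n \<Longrightarrow> \<bar>u2 (a + real j) - v2 (a + real j)\<bar> \<le> d"
      and last: "\<bar>u1 (a + real n) - v1 (a + real n)\<bar> \<le> e" "\<bar>u2 (a + real n) - v2 (a + real n)\<bar> \<le> e"
    for u1 u2 v1 v2 k d e
  proof -
    have de: "d \<ge> 0" "e \<ge> 0"
      using int(1)[OF k] last(1) by linarith+
    have "\<bar>?T1 u1 u2 (a + real k) - ?T1 v1 v2 (a + real k)\<bar> \<le> lam1 * (L1 + L2) * d + (L1 + L2) * e"
      unfolding assms(12) b by (rule green_op_diff_le[of \<alpha>1 k n L1 L2 a f1 u1 v1 d u2 v2 e, OF \<alpha>1 k L(1,2) lip1 int last])
    also have "\<dots> \<le> q * d + S * e"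
      using q1 S de by (intro add_mono mult_right_mono) auto
    finally show "\<bar>?T1 u1 u2 (a + real k) - ?T1 v1 v2 (a + real k)\<bar> \<le> q * d + S * e" .
    have "\<bar>?T2 u1 u2 (a + real k) - ?T2 v1 v2 (a + real k)\<bar> \<le> lam2 * (L3 + L4) * d + (L3 + L4) * e"
      unfolding assms(13) b by (rule green_op_diff_le[of \<alpha>2 k n L3 L4 a f2 u1 v1 d u2 v2 e, OF \<alpha>2 k L(3,4) lip2 int last])
    also have "\<dots> \<le> q * d + S * e"
      using q2 S de by (intro add_mono mult_right_mono) auto
    finally show "\<bar>?T2 u1 u2 (a + real k) - ?T2 v1 v2 (a + real k)\<bar> \<le> q * d + S * e" .
  qed
  \<comment> \<open>Extends interior values by 0, which is the value every fixed point has at both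
    end points.\<close>
  define ext where "ext w t = (if t \<in> (\<lambda>j. a + real j) ` {1..<n} then w t else 0)" for w :: "real \<Rightarrow> real" and t
  have ext_int: "ext w (a + real k) = w (a + real k)" if "1 \<le> k" "k < n" for w k
    using that by (auto simp: ext_def)
  have ext_n: "ext w (a + real n) = 0" for w
    by (auto simp: ext_def)
  have ext_grid: "ext w \<in> grid_space a (a + real n)" for w
    by (auto simp: ext_def grid_space_def N_upto_shift_0)
  have ext_fix: "ext w = green_op a (a + real n) \<alpha> f u1 u2"
    if \<alpha>: "1 < \<alpha>" "\<alpha> < 2" and eq: "\<And>k. 1 \<le> k \<Longrightarrow> k < n \<Longrightarrow> w (a + real k) = green_op a (a + real n) \<alpha> f u1 u2 (a + real k)"
    for w \<alpha> f u1 u2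
  proof
    fix t
    consider "t \<notin> N_upto a (a + real n)" | k where "k \<le> n" "t = a + real k"
      by atomize_elim (auto simp: N_upto_shift_0)
    then show "ext w t = green_op a (a + real n) \<alpha> f u1 u2 t"
    proof cases
      case 1
      then show ?thesis
        using ext_grid[of w] by (simp add: grid_space_def green_op_def)
    next
      case (2 k)
      consider "k = 0" | "k = n" | "1 \<le> k" "k < n"
        using \<open>k \<le> n\<close> by linarith
      then show ?thesis
      proof cases
        case 1
        then show ?thesis
          using 2 green_op_boundary(1)[OF \<alpha> n] by (auto simp: ext_def)
      next
        case 2
        then show ?thesis
          using \<open>t = a + real k\<close> green_op_boundary(2)[OF \<alpha> n] ext_n by simp
      next
        case 3
        then show ?thesis
          using 2 ext_int eq by simp
      qed
    qed
  qed

  \<comment> \<open>Existence of a fixed point\<close>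
  obtain v1 v2 where v: "v1 \<in> grid_space a (a + real n)" "v2 \<in> grid_space a (a + real n)"
      "v1 = ?T1 v1 v2" "v2 = ?T2 v1 v2"
  proof -
    \<comment> \<open>A pair of functions is coded as one function on
      \<open>bool \<times> real\<close>, with \<open>True\<close> for the first component, so the
      maximum runs over both components at once.\<close>
    define F where "F w i = (if fst i then ?T1 else ?T2) (ext (\<lambda>t. w (True, t))) (ext (\<lambda>t. w (False, t))) (snd i)"
      for w :: "bool \<times> real \<Rightarrow> real" and i :: "bool \<times> real"
    let ?I = "(UNIV :: bool set) \<times> (\<lambda>j. a + real j) ` {1..<n}"
    have "\<exists>w. \<forall>i\<in>?I. w i = F w i"
    proof (rule finite_sup_contraction_fixpoint[of _ q])
      fix w w' :: "bool \<times> real \<Rightarrow> real" and d i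
      assume i: "i \<in> ?I" and d: "\<And>j. j \<in> ?I \<Longrightarrow> \<bar>w j - w' j\<bar> \<le> d"
      obtain k where k: "1 \<le> k" "k < n" "snd i = a + real k"
        using i by auto
      \<comment> \<open>Extensions agree at the right end point, so the end point error is
        0.\<close>
      have "\<bar>F w i - F w' i\<bar> \<le> q * d + S * 0"
      proof (cases "fst i")
        case True
        show ?thesis
          unfolding F_def k(3) if_P[OF True] by (rule contr(1)[OF k(1,2)]) (auto simp: ext_int ext_n intro!: d)
      next
        case False
        show ?thesis
          unfolding F_def k(3) if_not_P[OF False] by (rule contr(2)[OF k(1,2)]) (auto simp: ext_int ext_n intro!: d)
      qed
      then show "\<bar>F w i - F w' i\<bar> \<le> q * d"
        by simp
    qed (use q in auto)
    then obtain w where w: "\<And>i. i \<in> ?I \<Longrightarrow> w i = F w i"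
      by blast
    define v1 v2 where "v1 = ext (\<lambda>t. w (True, t))" and "v2 = ext (\<lambda>t. w (False, t))"
    have "v1 = ?T1 v1 v2"
      unfolding v1_def by (rule ext_fix[OF \<alpha>1]) (use w in \<open>auto simp: F_def v1_def v2_def\<close>)
    moreover have "v2 = ?T2 v1 v2"
      unfolding v2_def by (rule ext_fix[OF \<alpha>2]) (use w in \<open>auto simp: F_def v1_def v2_def\<close>)
    moreover have "v1 \<in> grid_space a (a + real n)" "v2 \<in> grid_space a (a + real n)"
      by (simp_all only: v1_def v2_def ext_grid)
    ultimately show ?thesis
      using that by blast
  qed
  \<comment> \<open>Obtained by solving d \<le> e + q d + S e for d; this C serves as all four
    stability constants.\<close>
  define C where "C = (1 + S) / (1 - q)"
  have C: "C \<ge> 1" "C * (1 - q) = 1 + S"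
    using q S by (auto simp: C_def field_simps)

  \<comment> \<open>Distance from an approximate solution to the fixed point\<close>
  have stable: "grid_norm a (a + real n) (u1 - v1) \<le> C * \<epsilon>1 + C * \<epsilon>2 \<and> grid_norm a (a + real n) (u2 - v2) \<le> C * \<epsilon>1 + C * \<epsilon>2"
    if \<epsilon>: "\<epsilon>1 > 0" "\<epsilon>2 > 0" and res: "grid_norm a (a + real n) (u1 - ?T1 u1 u2) \<le> \<epsilon>1"
      "grid_norm a (a + real n) (u2 - ?T2 u1 u2) \<le> \<epsilon>2" for \<epsilon>1 \<epsilon>2 u1 u2
  proof -
    define e where "e = \<epsilon>1 + \<epsilon>2"
    have e: "e > 0"
      using \<epsilon> by (simp add: e_def)
    have u: "\<bar>u1 (a + real k) - ?T1 u1 u2 (a + real k)\<bar> \<le> e" "\<bar>u2 (a + real k) - ?T2 u1 u2 (a + real k)\<bar> \<le> e"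
      if "k \<le> n" for k
    proof -
      have "\<bar>u1 (a + real k) - ?T1 u1 u2 (a + real k)\<bar> \<le> \<epsilon>1" "\<bar>u2 (a + real k) - ?T2 u1 u2 (a + real k)\<bar> \<le> \<epsilon>2"
        using res that by (simp_all add: grid_norm_le_iff)
      then show "\<bar>u1 (a + real k) - ?T1 u1 u2 (a + real k)\<bar> \<le> e" "\<bar>u2 (a + real k) - ?T2 u1 u2 (a + real k)\<bar> \<le> e"
        using \<epsilon> by (simp_all add: e_def)
    qed
    \<comment> \<open>At the end points both the operators and the fixed point vanish, so the
      residual bounds the difference directly.\<close>
    have bd: "\<bar>u1 (a + real k) - v1 (a + real k)\<bar> \<le> e" "\<bar>u2 (a + real k) - v2 (a + real k)\<bar> \<le> e"
      if "k = 0 \<or> k = n" for k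
    proof -
      have T: "?T1 x1 x2 (a + real k) = 0" "?T2 x1 x2 (a + real k) = 0" for x1 x2
        using green_op_boundary[OF \<alpha>1 n] green_op_boundary[OF \<alpha>2 n] that by auto
      moreover have "v1 (a + real k) = 0" "v2 (a + real k) = 0"
        using fun_cong[OF v(3), of "a + real k"] fun_cong[OF v(4), of "a + real k"] by (simp_all only: T)
      ultimately show "\<bar>u1 (a + real k) - v1 (a + real k)\<bar> \<le> e" "\<bar>u2 (a + real k) - v2 (a + real k)\<bar> \<le> e"
        using u[of k] that by auto
    qed
    define d where "d = Max ((\<lambda>k. max \<bar>u1 (a + real k) - v1 (a + real k)\<bar> \<bar>u2 (a + real k) - v2 (a + real k)\<bar>) ` {1..<n})"
    have le_d: "\<bar>u1 (a + real k) - v1 (a + real k)\<bar> \<le> d" "\<bar>u2 (a + real k) - v2 (a + real k)\<bar> \<le> d"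
      if "1 \<le> k" "k < n" for k
    proof -
      have "max \<bar>u1 (a + real k) - v1 (a + real k)\<bar> \<bar>u2 (a + real k) - v2 (a + real k)\<bar> \<le> d"
        unfolding d_def using that by (intro Max_ge) auto
      then show "\<bar>u1 (a + real k) - v1 (a + real k)\<bar> \<le> d" "\<bar>u2 (a + real k) - v2 (a + real k)\<bar> \<le> d"
        by auto
    qed
    \<comment> \<open>Triangle inequality through T u: the residual gives e, and the contraction
      with end point error e gives the rest.\<close>
    have "d \<le> e + (q * d + S * e)"
    proof -
      have "\<bar>u1 (a + real k) - v1 (a + real k)\<bar> \<le> e + (q * d + S * e)"
           "\<bar>u2 (a + real k) - v2 (a + real k)\<bar> \<le> e + (q * d + S * e)" if k: "1 \<le> k" "k < n" for k
      proof -
        have "\<bar>?T1 u1 u2 (a + real k) - ?T1 v1 v2 (a + real k)\<bar> \<le> q * d + S * e"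
             "\<bar>?T2 u1 u2 (a + real k) - ?T2 v1 v2 (a + real k)\<bar> \<le> q * d + S * e"
          by (rule contr[OF k]; use le_d bd[of n] in simp)+
        moreover have "v1 (a + real k) = ?T1 v1 v2 (a + real k)" "v2 (a + real k) = ?T2 v1 v2 (a + real k)"
          by (rule fun_cong[OF v(3)], rule fun_cong[OF v(4)])
        ultimately show "\<bar>u1 (a + real k) - v1 (a + real k)\<bar> \<le> e + (q * d + S * e)"
            "\<bar>u2 (a + real k) - v2 (a + real k)\<bar> \<le> e + (q * d + S * e)"
          using u[of k] k by linarith+
      qed
      then show ?thesis
        unfolding d_def using n by (subst Max_le_iff) (auto simp: d_def[symmetric])
    qed
    then have "d * (1 - q) \<le> (1 + S) * e"
      by (simp add: algebra_simps)
    also have "\<dots> = C * e * (1 - q)"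
      unfolding C(2)[symmetric] by (simp only: mult_ac)
    finally have "d * (1 - q) \<le> C * e * (1 - q)" .
    then have "d \<le> C * e"
      using q by (simp only: mult_le_cancel_right_pos)
    have "e \<le> C * e"
      using C(1) e by simp
    have "\<bar>u1 (a + real k) - v1 (a + real k)\<bar> \<le> C * e \<and> \<bar>u2 (a + real k) - v2 (a + real k)\<bar> \<le> C * e" if "k \<le> n" for k
    proof (cases "k = 0 \<or> k = n")
      case True
      then show ?thesis
        using bd[of k] \<open>e \<le> C * e\<close> by linarith
    next
      case False
      then have "1 \<le> k" "k < n"
        using that by auto
      then show ?thesis
        using le_d[of k] \<open>d \<le> C * e\<close> by linarith
    qed
    then show ?thesis
      by (simp add: grid_norm_le_iff e_def distrib_left)
  qed
  have "ulam_hyers_stable (grid_space a b) (grid_norm a b) (green_op a b \<alpha>1 f1) (green_op a b \<alpha>2 f2)"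
    unfolding ulam_hyers_stable_def b
  proof (intro exI[of _ C] conjI allI impI ballI)
    fix \<epsilon>1 \<epsilon>2 u1 u2
    assume "\<epsilon>1 > 0" "\<epsilon>2 > 0" "grid_norm a (a + real n) (u1 - ?T1 u1 u2) \<le> \<epsilon>1"
      "grid_norm a (a + real n) (u2 - ?T2 u1 u2) \<le> \<epsilon>2"
    then show "\<exists>v1\<in>grid_space a (a + real n). \<exists>v2\<in>grid_space a (a + real n). v1 = ?T1 v1 v2 \<and> v2 = ?T2 v1 v2 \<and>
        grid_norm a (a + real n) (u1 - v1) \<le> C * \<epsilon>1 + C * \<epsilon>2 \<and>
        grid_norm a (a + real n) (u2 - v2) \<le> C * \<epsilon>1 + C * \<epsilon>2"
      using stable[of \<epsilon>1 \<epsilon>2 u1 u2] v by blast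
  qed (use C(1) in simp_all)
  then show ?thesis
    unfolding b using coupled_bvp_iff_green_op[OF \<alpha>1 \<alpha>2 n] by blast
qed

end
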